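(* The supercircle $S^{1,0}=\{(x,y)\in\mathbb{R}_S^{2,0}\mid x^2+y^2=1\}$ is a $(1,0)$-dimensional supermanifold.
   Context: $\mathbb{R}_S$ is the real Grassmann algebra on infinitely many generators $\beta_{[1]},\beta_{[2]},\dots$ with $\beta_{[i]}\beta_{[j]}=-\beta_{[j]}\beta_{[i]}$, whose elements are formal (possibly infinite) sums $x=\sum_{\underline\lambda}x_{\underline\lambda}\beta_{[\lambda_1]}\cdots\beta_{[\lambda_k]}$ with $x_{\underline\lambda}\in\mathbb{R}$, over all finite multi indices $\underline\lambda=\lambda_1\cdots\lambda_k$, $1\le\lambda_1<\cdots<\lambda_k$, $k\ge0$ (the empty multi index $\underline 0$ corresponds to $1$). $\mathbb{R}_{S_0}$ (resp. $\mathbb{R}_{S_1}$) consists of the sums involving only multi indices of even (resp. odd) length. The real superspace is $\mathbb{R}_S^{m,n}=(\mathbb{R}_{S_0})^m\times(\mathbb{R}_{S_1})^n$. The body map is $\epsilon(x)=x_{\underline 0}\in\mathbb{R}$, the soul map is $\sigma(x)=x-\epsilon(x)$, and $\epsilon^{m,n}(x_1,\dots,x_m,\xi_1,\dots,\xi_n)=(\epsilon(x_1),\dots,\epsilon(x_m))\in\mathbb{R}^m$. A subset $U\subset\mathbb{R}_S^{m,n}$ is open in the DeWitt topology iff $U=(\epsilon^{m,n})^{-1}(V)$ for some open $V\subset\mathbb{R}^m$. For $V\subset\mathbb{R}^m$ open and $f\in C^\infty(V,\mathbb{R}_S)$ (all real coefficient functions smooth), put $\widehat f(x)=\sum_{i_1,\dots,i_m\ge0}\frac1{i_1!\cdots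 i_m!}\partial_1^{i_1}\cdots\partial_m^{i_m}f(\epsilon(x_1),\dots,\epsilon(x_m))\,\sigma(x_1)^{i_1}\cdots\sigma(x_m)^{i_m}$. For $U\subset\mathbb{R}_S^{m,n}$ DeWitt open, a function $h:U\to\mathbb{R}_S$ is $G^\infty$ if there are $f_{\underline\mu}\in C^\infty(\epsilon^{m,n}(U),\mathbb{R}_S)$, indexed by the multi indices $\underline\mu=\mu_1\cdots\mu_k$ with $1\le\mu_1<\cdots<\mu_k\le n$ ($k\ge 0$), such that $h(x,\xi)=\sum_{\underline\mu}\widehat{f_{\underline\mu}}(x)\,\xi_{\mu_1}\cdots\xi_{\mu_k}$ on $U$; for $n=0$ this says $h=\widehat f$ for a single $f$. A map into $\mathbb{R}_S^{m,n}$ is $G^\infty$ if all its components are. A set $X$ is an $(m,n)$-dimensional supermanifold (an $(\mathbb{R}_S^{m,n},\text{DeWitt},G^\infty)$-supermanifold) if there exists an atlas: a family of subsets $U_\alpha\subset X$ covering $X$ with bijections $\phi_{U_\alpha}:U_\alpha\to\widehat U_\alpha$ onto DeWitt open sets $\widehat U_\alpha\subset\mathbb{R}_S^{m,n}$, such that for any two charts $U,V$ of the atlas the image $\phi_V(U\cap V)$ is DeWitt open and $\phi_U\circ\phi_V^{-1}$ is $G^\infty$ on it. *)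

theory Defs
  imports "HOL-Analysis.Analysis"
begin

text \<open>A multi index \<open>\<lambda>\<^sub>1 < \<dots> < \<lambda>\<^sub>k\<close> is the finite set \<open>{\<lambda>\<^sub>1, \<dots>, \<lambda>\<^sub>k}\<close> of its entries.  Generators and
  coordinates are numbered from \<open>0\<close> instead of \<open>1\<close>.  A formal sum is its family of coefficients,
  so the infinitely many generators impose no finiteness condition on the support; coefficients at
  infinite sets of indices are zero by convention.\<close>

typedef grassmann = "{c :: nat set \<Rightarrow> real. \<forall>A. infinite A \<longrightarrow> c A = 0}"
  morphisms coeff Abs_grassmann
  by (rule exI[of _ "\<lambda>_. 0"]) simp

setup_lifting type_definition_grassmann

lemma coeff_infinite [simp]: "infinite A \<Longrightarrow> coeff x A = 0"
  using coeff[of x] by blast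

lemma grassmann_eqI: "(\<And>A. finite A \<Longrightarrow> coeff x A = coeff y A) \<Longrightarrow> x = y"
  by (metis coeff_infinite coeff_inject ext)

text \<open>The sign produced by sorting the concatenation of the increasing words \<open>B\<close> and \<open>C\<close>.\<close>

definition shuffle_sign :: "nat set \<Rightarrow> nat set \<Rightarrow> real"
  where "shuffle_sign B C = (- 1) ^ card {(i, j). i \<in> B \<and> j \<in> C \<and> j < i}"

lemma shuffle_sign_empty [simp]: "shuffle_sign {} C = 1" "shuffle_sign B {} = 1"
  by (simp_all add: shuffle_sign_def)

lemma finite_inversions:
  assumes "finite B" "finite C"
  shows "finite {(i, j). i \<in> B \<and> j \<in> C \<and> j < (i::nat)}"
  by (rule finite_subset[of _ "B \<times> C"]) (use assms in auto)

lemma shuffle_sign_Un_left: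
  assumes "finite B" "finite C" "finite D" "B \<inter> C = {}"
  shows "shuffle_sign (B \<union> C) D = shuffle_sign B D * shuffle_sign C D"
proof -
  have "{(i, j). i \<in> B \<union> C \<and> j \<in> D \<and> j < i}
      = {(i, j). i \<in> B \<and> j \<in> D \<and> j < i} \<union> {(i, j). i \<in> C \<and> j \<in> D \<and> j < i}" by auto
  moreover have "card \<dots> = card {(i, j). i \<in> B \<and> j \<in> D \<and> j < i} + card {(i, j). i \<in> C \<and> j \<in> D \<and> j < i}"
    by (rule card_Un_disjoint) (use assms finite_inversions in auto)
  ultimately show ?thesis by (simp add: shuffle_sign_def power_add)
qed

lemma shuffle_sign_Un_right:
  assumes "finite B" "finite C" "finite D" "C \<inter> D = {}"
  shows "shuffle_sign B (C \<union> D) = shuffle_sign B C * shuffle_sign B D"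
proof -
  have "{(i, j). i \<in> B \<and> j \<in> C \<union> D \<and> j < i}
      = {(i, j). i \<in> B \<and> j \<in> C \<and> j < i} \<union> {(i, j). i \<in> B \<and> j \<in> D \<and> j < i}" by auto
  moreover have "card \<dots> = card {(i, j). i \<in> B \<and> j \<in> C \<and> j < i} + card {(i, j). i \<in> B \<and> j \<in> D \<and> j < i}"
    by (rule card_Un_disjoint) (use assms finite_inversions in auto)
  ultimately show ?thesis by (simp add: shuffle_sign_def power_add)
qed

instantiation grassmann :: real_algebra_1
begin

lift_definition zero_grassmann :: grassmann is "\<lambda>_. 0" by simp
lift_definition one_grassmann :: grassmann is "\<lambda>A. if A = {} then 1 else 0" by auto
lift_definition plus_grassmann :: "grassmann \<Rightarrow> grassmann \<Rightarrow> grassmann" is "\<lambda>c d A. c A + d A" by simp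
lift_definition minus_grassmann :: "grassmann \<Rightarrow> grassmann \<Rightarrow> grassmann" is "\<lambda>c d A. c A - d A" by simp
lift_definition uminus_grassmann :: "grassmann \<Rightarrow> grassmann" is "\<lambda>c A. - c A" by simp
lift_definition scaleR_grassmann :: "real \<Rightarrow> grassmann \<Rightarrow> grassmann" is "\<lambda>r c A. r * c A" by simp
lift_definition times_grassmann :: "grassmann \<Rightarrow> grassmann \<Rightarrow> grassmann"
  is "\<lambda>c d A. \<Sum>B\<in>Pow A. shuffle_sign B (A - B) * c B * d (A - B)"
  by simp

instance
proof
  fix a b c :: grassmann and r s :: real
  show "a + b + c = a + (b + c)" "a + b = b + a" "0 + a = a" "- a + a = 0" "a - b = a + - b"
    by (transfer; auto simp: fun_eq_iff)+
  show "r *\<^sub>R (a + b) = r *\<^sub>R a + r *\<^sub>R b" "(r + s) *\<^sub>R a = r *\<^sub>R a + s *\<^sub>R a"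
    "r *\<^sub>R s *\<^sub>R a = (r * s) *\<^sub>R a" "1 *\<^sub>R a = a"
    by (transfer; auto simp: fun_eq_iff algebra_simps)+
  show "(a + b) * c = a * c + b * c" "a * (b + c) = a * b + a * c"
    "r *\<^sub>R a * b = r *\<^sub>R (a * b)" "a * r *\<^sub>R b = r *\<^sub>R (a * b)"
    by (transfer; auto simp: fun_eq_iff algebra_simps sum.distrib sum_distrib_left)+
  show "(0::grassmann) \<noteq> 1"
    by transfer (auto simp: fun_eq_iff)
  show "1 * a = a"
  proof (rule grassmann_eqI)
    fix A :: "nat set" assume A: "finite A"
    have "coeff (1 * a) A = (\<Sum>B\<in>Pow A. if B = {} then coeff a A else 0)"
      unfolding times_grassmann.rep_eq one_grassmann.rep_eq by (rule sum.cong) auto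
    then show "coeff (1 * a) A = coeff a A" using A by simp
  qed
  show "a * 1 = a"
  proof (rule grassmann_eqI)
    fix A :: "nat set" assume A: "finite A"
    have "coeff (a * 1) A = (\<Sum>B\<in>Pow A. if B = A then coeff a A else 0)"
      unfolding times_grassmann.rep_eq one_grassmann.rep_eq by (rule sum.cong) auto
    then show "coeff (a * 1) A = coeff a A" using A by simp
  qed
  show "a * b * c = a * (b * c)"
  proof (rule grassmann_eqI)
    fix A :: "nat set" assume A: "finite A"
    have fin: "finite B" if "B \<subseteq> A" for B using that A finite_subset by blast
    have "coeff (a * b * c) A = (\<Sum>B\<in>Pow A. \<Sum>C\<in>Pow B.
        shuffle_sign B (A - B) * shuffle_sign C (B - C) * coeff a C * coeff b (B - C) * coeff c (A - B))"
      unfolding times_grassmann.rep_eq by (simp add: sum_distrib_left sum_distrib_right mult_ac)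
    also have "\<dots> = (\<Sum>(B, C)\<in>(SIGMA B:Pow A. Pow B).
        shuffle_sign B (A - B) * shuffle_sign C (B - C) * coeff a C * coeff b (B - C) * coeff c (A - B))"
      by (rule sum.Sigma) (use A fin in auto)
    also have "\<dots> = (\<Sum>(C, D)\<in>(SIGMA C:Pow A. Pow (A - C)).
        shuffle_sign C (A - C) * shuffle_sign D (A - C - D) * coeff a C * coeff b D * coeff c (A - C - D))"
    proof (rule sum.reindex_bij_witness[of _ "\<lambda>(C, D). (C \<union> D, C)" "\<lambda>(B, C). (C, B - C)"])
      fix p assume "p \<in> (SIGMA B:Pow A. Pow B)"
      then obtain B C where p: "p = (B, C)" and sub: "B \<subseteq> A" "C \<subseteq> B" by auto
      have B: "B = C \<union> (B - C)" and E: "A - C = (B - C) \<union> (A - B)" and F: "A - C - (B - C) = A - B"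
        using sub by auto
      have f: "finite C" "finite (B - C)" "finite (A - B)" using sub fin A by auto
      have "shuffle_sign B (A - B) = shuffle_sign C (A - B) * shuffle_sign (B - C) (A - B)"
        by (subst B, rule shuffle_sign_Un_left) (use f in auto)
      moreover have "shuffle_sign C (A - C) = shuffle_sign C (B - C) * shuffle_sign C (A - B)"
        by (subst E, rule shuffle_sign_Un_right) (use f in auto)
      ultimately show "(case case p of (B, C) \<Rightarrow> (C, B - C) of (C, D) \<Rightarrow>
          shuffle_sign C (A - C) * shuffle_sign D (A - C - D) * coeff a C * coeff b D * coeff c (A - C - D))
        = (case p of (B, C) \<Rightarrow>
          shuffle_sign B (A - B) * shuffle_sign C (B - C) * coeff a C * coeff b (B - C) * coeff c (A - B))"
        by (simp add: p F)
    qed auto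
    also have "\<dots> = (\<Sum>C\<in>Pow A. \<Sum>D\<in>Pow (A - C).
        shuffle_sign C (A - C) * shuffle_sign D (A - C - D) * coeff a C * coeff b D * coeff c (A - C - D))"
      by (rule sum.Sigma[symmetric]) (use A fin in auto)
    also have "\<dots> = coeff (a * (b * c)) A"
      unfolding times_grassmann.rep_eq by (simp add: sum_distrib_left sum_distrib_right mult_ac)
    finally show "coeff (a * b * c) A = coeff (a * (b * c)) A" .
  qed
qed

end

text \<open>The product is determined by the following two facts (and coefficientwise finiteness): the
  generators anticommute, and the coefficient family of \<open>\<beta>\<^bsub>[\<lambda>\<^sub>1]\<^esub> \<cdots> \<beta>\<^bsub>[\<lambda>\<^sub>k]\<^esub>\<close> is the
  indicator of \<open>{\<lambda>\<^sub>1, \<dots>, \<lambda>\<^sub>k}\<close>.\<close>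

lift_definition grassmann_gen :: "nat \<Rightarrow> grassmann" is "\<lambda>i A. if A = {i} then 1 else 0" by auto

lemma coeff_gen_times:
  "finite A \<Longrightarrow> coeff (grassmann_gen i * x) A
     = (if i \<in> A then shuffle_sign {i} (A - {i}) * coeff x (A - {i}) else 0)"
proof -
  assume A: "finite A"
  have "coeff (grassmann_gen i * x) A
      = (\<Sum>B\<in>Pow A. if B = {i} then shuffle_sign {i} (A - {i}) * coeff x (A - {i}) else 0)"
    unfolding times_grassmann.rep_eq grassmann_gen.rep_eq by (rule sum.cong) auto
  then show ?thesis using A by simp
qed

lemma grassmann_gen_anticommute: "grassmann_gen i * grassmann_gen j = - (grassmann_gen j * grassmann_gen i)"
proof (rule grassmann_eqI)
  fix A :: "nat set" assume A: "finite A"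
  have s: "shuffle_sign {i} {j} = (if j < i then - 1 else 1)" for i j
  proof -
    have "{(i', j'). i' \<in> {i} \<and> j' \<in> {j} \<and> j' < i'} = (if j < i then {(i, j)} else {})" by auto
    then show ?thesis by (simp add: shuffle_sign_def)
  qed
  have *: "coeff (grassmann_gen i * grassmann_gen j) A
      = (if A = {i, j} \<and> i \<noteq> j then shuffle_sign {i} {j} else 0)" for i j
    by (subst coeff_gen_times[OF A]) (auto simp: grassmann_gen.rep_eq insert_Diff_if)
  show "coeff (grassmann_gen i * grassmann_gen j) A = coeff (- (grassmann_gen j * grassmann_gen i)) A"
    unfolding uminus_grassmann.rep_eq * s by (auto simp: insert_commute)
qed

lemma coeff_grassmann_monomial:
  assumes "sorted_wrt (<) ks"
  shows "coeff (prod_list (map grassmann_gen ks)) A = (if A = set ks then 1 else 0)"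
  using assms
proof (induction ks arbitrary: A)
  case Nil
  then show ?case by (simp add: one_grassmann.rep_eq)
next
  case (Cons k ks)
  have "{(i, j). i \<in> {k} \<and> j \<in> set ks \<and> j < i} = {}" using Cons.prems by auto
  then have s: "shuffle_sign {k} (set ks) = 1" by (simp only: shuffle_sign_def card.empty power_0)
  have k: "k \<notin> set ks" using Cons.prems by auto
  show ?case
  proof (cases "finite A")
    case True
    have "A - {k} = set ks \<longleftrightarrow> A = set (k # ks)" if "k \<in> A" using that k by auto
    moreover have "A \<noteq> set (k # ks)" if "k \<notin> A" using that by auto
    ultimately show ?thesis
      using True Cons s k by (auto simp: coeff_gen_times simp del: times_grassmann.rep_eq)
  qed auto
qed

definition grassmann_even :: "grassmann set"
  where "grassmann_even = {x. \<forall>A. odd (card A) \<longrightarrow> coeff x A = 0}"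

definition grassmann_odd :: "grassmann set"
  where "grassmann_odd = {x. \<forall>A. even (card A) \<longrightarrow> coeff x A = 0}"

definition body :: "grassmann \<Rightarrow> real"
  where "body x = coeff x {}"

definition soul :: "grassmann \<Rightarrow> grassmann"
  where "soul x = x - of_real (body x)"

text \<open>As in \<^const>\<open>Euclidean_space\<close>, a tuple of length \<open>m\<close> is a sequence which is zero from
  position \<open>m\<close> on.\<close>

type_synonym superpoint = "(nat \<Rightarrow> grassmann) \<times> (nat \<Rightarrow> grassmann)"

definition superspace :: "nat \<Rightarrow> nat \<Rightarrow> superpoint set"
  where "superspace m n = {(x, \<xi>).
    (\<forall>i<m. x i \<in> grassmann_even) \<and> (\<forall>i\<ge>m. x i = 0) \<and>
    (\<forall>j<n. \<xi> j \<in> grassmann_odd) \<and> (\<forall>j\<ge>n. \<xi> j = 0)}"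

definition body_map :: "superpoint \<Rightarrow> nat \<Rightarrow> real"
  where "body_map p = (\<lambda>i. body (fst p i))"

definition dewitt_open :: "nat \<Rightarrow> nat \<Rightarrow> superpoint set \<Rightarrow> bool"
  where "dewitt_open m n U \<longleftrightarrow>
    (\<exists>V. openin (Euclidean_space m) V \<and> U = {p \<in> superspace m n. body_map p \<in> V})"

definition partial_deriv :: "nat \<Rightarrow> ((nat \<Rightarrow> real) \<Rightarrow> real) \<Rightarrow> (nat \<Rightarrow> real) \<Rightarrow> real"
  where "partial_deriv k g = (\<lambda>p. deriv (\<lambda>t. g (p(k := t))) (p k))"

text \<open>All iterated partial derivatives exist and are continuous.  For \<open>V\<close> open, they only depend
  on the values of \<open>g\<close> on \<open>V\<close>.\<close>

definition smooth_real_on :: "nat \<Rightarrow> (nat \<Rightarrow> real) set \<Rightarrow> ((nat \<Rightarrow> real) \<Rightarrow> real) \<Rightarrow> bool"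
  where "smooth_real_on m V g \<longleftrightarrow> (\<forall>ks\<in>lists {..<m}.
    continuous_map (subtopology (Euclidean_space m) V) euclideanreal (foldr partial_deriv ks g) \<and>
    (\<forall>p\<in>V. \<forall>k<m. (\<lambda>t. foldr partial_deriv ks g (p(k := t))) differentiable at (p k)))"

definition smooth_on :: "nat \<Rightarrow> (nat \<Rightarrow> real) set \<Rightarrow> ((nat \<Rightarrow> real) \<Rightarrow> grassmann) \<Rightarrow> bool"
  where "smooth_on m V f \<longleftrightarrow> (\<forall>A. smooth_real_on m V (\<lambda>p. coeff (f p) A))"

text \<open>\<open>\<partial>\<^sub>1\<^bsup>i\<^sub>1\<^esup> \<cdots> \<partial>\<^sub>m\<^bsup>i\<^sub>m\<^esup> f\<close>, taken coefficientwise.\<close>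

lift_definition multi_deriv ::
  "nat \<Rightarrow> (nat \<Rightarrow> nat) \<Rightarrow> ((nat \<Rightarrow> real) \<Rightarrow> grassmann) \<Rightarrow> (nat \<Rightarrow> real) \<Rightarrow> grassmann"
  is "\<lambda>m i f p A. if finite A
        then foldr (\<lambda>k. partial_deriv k ^^ i k) [0..<m] (\<lambda>q. f q A) p else 0"
  by simp

definition taylor_term ::
  "nat \<Rightarrow> ((nat \<Rightarrow> real) \<Rightarrow> grassmann) \<Rightarrow> (nat \<Rightarrow> grassmann) \<Rightarrow> (nat \<Rightarrow> nat) \<Rightarrow> grassmann"
  where "taylor_term m f x i =
    (1 / (\<Prod>k<m. fact (i k))) *\<^sub>R
      (multi_deriv m i f (\<lambda>k. body (x k)) * prod_list (map (\<lambda>k. soul (x k) ^ i k) [0..<m]))"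

text \<open>The sum over all \<open>i \<in> \<nat>\<^sup>m\<close> is formed separately for each coefficient, where it has only
  finitely many nonzero terms: \<open>soul (x k) ^ i k\<close> has no terms of length less than \<open>i k\<close>.\<close>

definition grassmann_ext ::
  "nat \<Rightarrow> ((nat \<Rightarrow> real) \<Rightarrow> grassmann) \<Rightarrow> (nat \<Rightarrow> grassmann) \<Rightarrow> grassmann"
  where "grassmann_ext m f x =
    Abs_grassmann (\<lambda>A. \<Sum>\<^sub>\<infinity>i\<in>{i. \<forall>k\<ge>m. i k = 0}. coeff (taylor_term m f x i) A)"

lemma coeff_grassmann_ext:
  "coeff (grassmann_ext m f x) A = (\<Sum>\<^sub>\<infinity>i\<in>{i. \<forall>k\<ge>m. i k = 0}. coeff (taylor_term m f x i) A)"
  unfolding grassmann_ext_def by (subst Abs_grassmann_inverse) auto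

definition G_infinity :: "nat \<Rightarrow> nat \<Rightarrow> superpoint set \<Rightarrow> (superpoint \<Rightarrow> grassmann) \<Rightarrow> bool"
  where "G_infinity m n U h \<longleftrightarrow> (\<exists>f :: nat set \<Rightarrow> (nat \<Rightarrow> real) \<Rightarrow> grassmann.
    (\<forall>M\<in>Pow {..<n}. smooth_on m (body_map ` U) (f M)) \<and>
    (\<forall>(x, \<xi>)\<in>U. h (x, \<xi>) =
      (\<Sum>M\<in>Pow {..<n}. grassmann_ext m (f M) x * prod_list (map \<xi> (sorted_list_of_set M)))))"

definition G_infinity_map ::
  "nat \<Rightarrow> nat \<Rightarrow> nat \<Rightarrow> nat \<Rightarrow> superpoint set \<Rightarrow> (superpoint \<Rightarrow> superpoint) \<Rightarrow> bool"
  where "G_infinity_map m n m' n' U F \<longleftrightarrow> F ` U \<subseteq> superspace m' n' \<and>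
    (\<forall>i<m'. G_infinity m n U (\<lambda>p. fst (F p) i)) \<and>
    (\<forall>j<n'. G_infinity m n U (\<lambda>p. snd (F p) j))"

definition super_atlas :: "nat \<Rightarrow> nat \<Rightarrow> 'a set \<Rightarrow> ('a set \<times> ('a \<Rightarrow> superpoint)) set \<Rightarrow> bool"
  where "super_atlas m n X \<A> \<longleftrightarrow>
    (\<forall>(U, \<phi>)\<in>\<A>. U \<subseteq> X \<and> (\<exists>W. dewitt_open m n W \<and> bij_betw \<phi> U W)) \<and>
    (\<Union>(U, \<phi>)\<in>\<A>. U) = X \<and>
    (\<forall>(U, \<phi>)\<in>\<A>. \<forall>(V, \<psi>)\<in>\<A>. dewitt_open m n (\<psi> ` (U \<inter> V)) \<and>
      G_infinity_map m n m n (\<psi> ` (U \<inter> V)) (\<phi> \<circ> inv_into V \<psi>))"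

definition supermanifold :: "nat \<Rightarrow> nat \<Rightarrow> 'a set \<Rightarrow> bool"
  where "supermanifold m n X \<longleftrightarrow> (\<exists>\<A>. super_atlas m n X \<A>)"

definition supercircle :: "superpoint set"
  where "supercircle = {p \<in> superspace 2 0. (fst p 0)\<^sup>2 + (fst p 1)\<^sup>2 = 1}"

end

theory Submission
  imports Defs
begin

text \<open>Stereographic projection from the two poles \<open>(0, 1)\<close> and \<open>(0, -1)\<close> works over the even Grassmann
  numbers just as over the reals.  For \<open>s = \<plusminus>1\<close>, the chart
  \<open>(x, y) \<mapsto> x (1 - s y)\<^sup>-\<^sup>1\<close> is defined on the points of the circle where the body of \<open>y\<close> is not \<open>s\<close>.
  It is a bijection onto all even numbers, because the rational parametrization
  \<open>t \<mapsto> (2 t u, s (t\<^sup>2 - 1) u)\<close> with \<open>u = (1 + t\<^sup>2)\<^sup>-\<^sup>1\<close> inverts it by a calculation valid in every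
  commutative real algebra that contains these inverses (lemmas \<open>stereographic_circle_param\<close> and
  \<open>circle_param_stereographic\<close>).  The overlap of the two charts is \<open>{t. body t \<noteq> 0}\<close>, a DeWitt open set,
  and the change of charts is \<open>t \<mapsto> t\<^sup>-\<^sup>1\<close> (lemma \<open>stereographic_opposite\<close>).

  Two facts about Grassmann numbers make this work.  Even elements are central
  (\<open>even_central\<close>), since moving an even number of generators past anything costs no sign.  And
  an element with nonzero body is invertible by the geometric series in its soul, which is finite in
  each coefficient because the soul has no constant term.  That series is also the Taylor series
  of the real function \<open>1/t\<close>, so the inverse is the Grassmann extension of \<open>1/t\<close>
  (\<open>super_inverse_right\<close>) and therefore \<open>G\<^sup>\<infinity>\<close>.\<close>

section \<open>The Grassmann algebra: body, soul and central even part\<close>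

lemma coeff_of_real: "coeff (of_real r) A = r * coeff 1 A"
  by (simp add: of_real_def scaleR_grassmann.rep_eq)

lemma coeff_sum: "coeff (\<Sum>i\<in>I. f i) A = (\<Sum>i\<in>I. coeff (f i) A)"
  by (induction I rule: infinite_finite_induct)
    (simp_all add: zero_grassmann.rep_eq plus_grassmann.rep_eq)

lemma body_simps [simp]:
  "body 0 = 0" "body 1 = 1" "body (of_real r) = r" "body (x + y) = body x + body y"
  "body (x - y) = body x - body y" "body (- x) = - body x" "body (r *\<^sub>R x) = r * body x"
  "body (x * y) = body x * body y"
  by (simp_all add: body_def coeff_of_real zero_grassmann.rep_eq one_grassmann.rep_eq
      plus_grassmann.rep_eq minus_grassmann.rep_eq uminus_grassmann.rep_eq
      scaleR_grassmann.rep_eq times_grassmann.rep_eq)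

lemma body_power [simp]: "body (x ^ n) = body x ^ n"
  by (induction n) simp_all

lemma body_plus_soul: "of_real (body x) + soul x = x"
  by (simp add: soul_def)

text \<open>This allows an infinite series to be replaced, inside a product, by a partial sum that agrees
  with it on the subsets of a given multi index.\<close>

lemma coeff_times_cong:
  assumes "\<And>B. B \<subseteq> A \<Longrightarrow> coeff x B = coeff x' B" "\<And>B. B \<subseteq> A \<Longrightarrow> coeff y B = coeff y' B"
  shows "coeff (x * y) A = coeff (x' * y') A"
  unfolding times_grassmann.rep_eq by (rule sum.cong) (use assms in auto)

text \<open>Each factor \<open>soul x\<close> uses up at least one index, because its constant term vanishes.\<close>

lemma coeff_soul_power_eq_0:
  assumes "finite A" "card A < n"
  shows "coeff (soul x ^ n) A = 0"
  using assms
proof (induction n arbitrary: A)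
  case (Suc n)
  have "coeff (soul x) B * coeff (soul x ^ n) (A - B) = 0" if "B \<subseteq> A" for B
  proof (cases "B = {}")
    case True
    have "body (soul x) = 0" by (simp add: soul_def)
    then show ?thesis using True by (simp add: body_def)
  next
    case False
    then have "card (A - B) < card A"
      using that Suc.prems by (intro psubset_card_mono) auto
    then show ?thesis using Suc.IH[of "A - B"] Suc.prems by simp
  qed
  then show ?case
    by (auto simp: times_grassmann.rep_eq mult.assoc intro!: sum.neutral)
qed simp

text \<open>The inversions of \<open>B C\<close> and of \<open>C B\<close> together are all pairs in \<open>B \<times> C\<close>, so their numbers have the
  same parity when \<open>card B * card C\<close> is even.\<close>

lemma shuffle_sign_swap:
  assumes "finite B" "finite C" "B \<inter> C = {}" "even (card B * card C)"
  shows "shuffle_sign B C = shuffle_sign C B"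
proof -
  let ?I = "\<lambda>B C. {(i, j). i \<in> B \<and> j \<in> C \<and> j < (i::nat)}"
  have "B \<times> C = ?I B C \<union> prod.swap ` ?I C B"
    using assms(3) by (auto simp: image_iff not_less le_less)
  moreover have "card (?I B C \<union> prod.swap ` ?I C B) = card (?I B C) + card (prod.swap ` ?I C B)"
    by (rule card_Un_disjoint) (use assms finite_inversions in auto)
  moreover have "card (prod.swap ` ?I C B) = card (?I C B)"
    by (rule card_image) (auto simp: inj_on_def)
  ultimately have "card B * card C = card (?I B C) + card (?I C B)"
    unfolding card_cartesian_product[symmetric] by simp
  with assms(4) have "even (card (?I B C)) \<longleftrightarrow> even (card (?I C B))" by simp
  then show ?thesis unfolding shuffle_sign_def by (simp only: minus_one_power_iff)
qed

text \<open>Passing to complements of \<open>B\<close> exchanges the factors; it changes the sign of a summand only if both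
  multi indices have odd length, and then the coefficient of \<open>x\<close> is zero.\<close>

lemma even_central:
  assumes "x \<in> grassmann_even"
  shows "x * y = y * x"
proof (rule grassmann_eqI)
  fix A :: "nat set" assume A: "finite A"
  have "coeff (x * y) A = (\<Sum>B\<in>Pow A. shuffle_sign (A - B) B * coeff x (A - B) * coeff y B)"
    unfolding times_grassmann.rep_eq
    by (rule sum.reindex_bij_witness[of _ "\<lambda>B. A - B" "\<lambda>B. A - B"]) (auto simp: double_diff)
  also have "\<dots> = coeff (y * x) A"
    unfolding times_grassmann.rep_eq
  proof (rule sum.cong)
    fix B assume "B \<in> Pow A"
    then have fin: "finite B" "finite (A - B)" using A finite_subset by auto
    show "shuffle_sign (A - B) B * coeff x (A - B) * coeff y B
        = shuffle_sign B (A - B) * coeff y B * coeff x (A - B)"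
    proof (cases "odd (card (A - B))")
      case True
      then show ?thesis using assms by (simp add: grassmann_even_def)
    next
      case False
      then have "shuffle_sign (A - B) B = shuffle_sign B (A - B)"
        using fin by (intro shuffle_sign_swap) auto
      then show ?thesis by simp
    qed
  qed simp
  finally show "coeff (x * y) A = coeff (y * x) A" .
qed

lemma even_closed [simp, intro]:
  "0 \<in> grassmann_even" "1 \<in> grassmann_even"
  "x \<in> grassmann_even \<Longrightarrow> y \<in> grassmann_even \<Longrightarrow> x + y \<in> grassmann_even"
  "x \<in> grassmann_even \<Longrightarrow> y \<in> grassmann_even \<Longrightarrow> x - y \<in> grassmann_even"
  "x \<in> grassmann_even \<Longrightarrow> r *\<^sub>R x \<in> grassmann_even"
  by (auto simp: grassmann_even_def zero_grassmann.rep_eq one_grassmann.rep_eq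
      plus_grassmann.rep_eq minus_grassmann.rep_eq scaleR_grassmann.rep_eq)

lemma even_mult [simp, intro]:
  assumes "x \<in> grassmann_even" "y \<in> grassmann_even"
  shows "x * y \<in> grassmann_even"
  unfolding grassmann_even_def
proof (intro CollectI allI impI)
  fix A :: "nat set" assume A: "odd (card A)"
  then have fin: "finite A" using card.infinite by fastforce
  have "coeff x B * coeff y (A - B) = 0" if "B \<subseteq> A" for B
  proof -
    have "card A = card B + card (A - B)"
      using that fin by (metis card_Diff_subset card_mono finite_subset le_add_diff_inverse)
    with A have "odd (card B) \<or> odd (card (A - B))" by (metis even_add)
    then show ?thesis using assms by (auto simp: grassmann_even_def)
  qed
  then show "coeff (x * y) A = 0"
    by (auto simp: times_grassmann.rep_eq mult.assoc intro!: sum.neutral)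
qed

lemma even_power [simp, intro]: "x \<in> grassmann_even \<Longrightarrow> x ^ n \<in> grassmann_even"
  by (induction n) simp_all

lemma even_soul [simp, intro]: "x \<in> grassmann_even \<Longrightarrow> soul x \<in> grassmann_even"
  by (simp add: soul_def of_real_def)

section \<open>Superfunctions of one even variable\<close>

lemma foldr_partial_deriv:
  assumes "ks \<in> lists {..<1::nat}"
  shows "foldr partial_deriv ks g = (partial_deriv 0 ^^ length ks) g"
  using assms by (induction ks) auto

text \<open>A smooth function of one real variable enters together with all its derivatives, \<open>D 0\<close> being the
  function itself.  Outside \<open>W\<close> the \<open>D n\<close> are arbitrary, whereas iterated \<^const>\<open>deriv\<close> may
  have unspecified values there; all comparisons are therefore made on \<open>W\<close>.\<close>

definition derivative_sequence :: "real set \<Rightarrow> (nat \<Rightarrow> real \<Rightarrow> real) \<Rightarrow> bool"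
  where "derivative_sequence W D \<longleftrightarrow> open W \<and>
    (\<forall>n. \<forall>t\<in>W. (D n has_real_derivative D (Suc n) t) (at t))"

lemma derivative_sequenceD:
  assumes "derivative_sequence W D"
  shows "open W" "t \<in> W \<Longrightarrow> (D n has_real_derivative D (Suc n) t) (at t)"
  using assms by (auto simp: derivative_sequence_def)

text \<open>The factor \<open>c\<close> is there because each coefficient of \<open>of_real (D 0 t)\<close> is a constant multiple of
  \<open>D 0 t\<close>.\<close>

lemma iterated_partial_deriv:
  assumes D: "derivative_sequence W D"
    and "p 0 \<in> W"
  shows "(partial_deriv 0 ^^ n) (\<lambda>p. D 0 (p 0) * c) p = D n (p 0) * c"
  using assms(2)
proof (induction n arbitrary: p)
  case (Suc n)
  let ?g = "(partial_deriv 0 ^^ n) (\<lambda>p. D 0 (p 0) * c)"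
  have "((\<lambda>t. D n t * c) has_real_derivative D (Suc n) (p 0) * c) (at (p 0))"
    by (rule DERIV_cmult_right) (rule derivative_sequenceD(2)[OF D Suc.prems])
  then have "((\<lambda>t. ?g (p(0 := t))) has_real_derivative D (Suc n) (p 0) * c) (at (p 0))"
    by (rule has_field_derivative_transform_within_open[OF _ derivative_sequenceD(1)[OF D] Suc.prems])
      (simp add: Suc.IH)
  then show ?case by (simp add: DERIV_imp_deriv partial_deriv_def[of 0 ?g])
qed simp

lemma smooth_on_one_variable:
  assumes D: "derivative_sequence W D"
    and V: "\<And>p. p \<in> V \<Longrightarrow> p 0 \<in> W"
  shows "smooth_on 1 V (\<lambda>p. of_real (D 0 (p 0)))"
  unfolding smooth_on_def smooth_real_on_def coeff_of_real
proof (intro allI ballI conjI impI)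
  fix A :: "nat set" and ks :: "nat list"
  assume ks: "ks \<in> lists {..<1}"
  let ?c = "coeff 1 A" and ?n = "length ks"
  let ?g = "foldr partial_deriv ks (\<lambda>p. D 0 (p 0) * ?c)"
  have g: "?g p = D ?n (p 0) * ?c" if "p 0 \<in> W" for p
    unfolding foldr_partial_deriv[OF ks] by (rule iterated_partial_deriv) (rule D that)+
  have "continuous_on W (D ?n)"
    by (rule DERIV_continuous_on[where D = "D (Suc ?n)"])
      (rule has_field_derivative_at_within[OF derivative_sequenceD(2)[OF D]])
  then have "continuous_on W (\<lambda>t. D ?n t * ?c)" by (rule continuous_on_mult_right)
  then have "continuous_map (top_of_set W) euclideanreal (\<lambda>t. D ?n t * ?c)" by simp
  moreover have "continuous_map (subtopology (Euclidean_space 1) V) (top_of_set W) (\<lambda>p. p 0)"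
    by (auto simp: continuous_map_in_subtopology Euclidean_space_def V
        intro!: continuous_map_from_subtopology continuous_map_product_projection)
  ultimately have "continuous_map (subtopology (Euclidean_space 1) V) euclideanreal
      ((\<lambda>t. D ?n t * ?c) \<circ> (\<lambda>p. p 0))"
    by (rule continuous_map_compose[rotated])
  then show "continuous_map (subtopology (Euclidean_space 1) V) euclideanreal ?g"
    by (rule continuous_map_eq) (simp add: g V)
  fix p k assume "p \<in> V" "k < (1::nat)"
  then have k: "k = 0" and p: "p 0 \<in> W" using V by auto
  have "((\<lambda>t. D ?n t * ?c) has_real_derivative D (Suc ?n) (p 0) * ?c) (at (p 0))"
    by (rule DERIV_cmult_right) (rule derivative_sequenceD(2)[OF D p])
  then have "((\<lambda>t. ?g (p(0 := t))) has_real_derivative D (Suc ?n) (p 0) * ?c) (at (p 0))"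
    by (rule has_field_derivative_transform_within_open[OF _ derivative_sequenceD(1)[OF D] p])
      (simp add: g)
  then show "(\<lambda>t. ?g (p(k := t))) differentiable at (p k)"
    unfolding k real_differentiable_def by blast
qed

text \<open>At the multi index \<open>A\<close> the Taylor series stops at order \<open>card A\<close>, since higher powers of the soul
  do not reach \<open>A\<close>.  The free bound \<open>N\<close> lets one polynomial serve all subsets of \<open>A\<close> at once.\<close>

lemma coeff_ext_one_variable:
  assumes D: "derivative_sequence W D"
    and b: "body (x 0) \<in> W" and A: "finite A" "card A \<le> N"
  shows "coeff (grassmann_ext 1 (\<lambda>p. of_real (D 0 (p 0))) x) A
    = coeff (\<Sum>n\<le>N. (D n (body (x 0)) / fact n) *\<^sub>R soul (x 0) ^ n) A"
proof -
  let ?f = "\<lambda>p::nat \<Rightarrow> real. of_real (D 0 (p 0)) :: grassmann"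
    and ?I = "{i :: nat \<Rightarrow> nat. \<forall>k\<ge>1. i k = 0}"
  let ?a = "\<lambda>n. coeff ((D n (body (x 0)) / fact n) *\<^sub>R soul (x 0) ^ n) A"
  have md: "multi_deriv 1 i ?f (\<lambda>k. body (x k)) = of_real (D (i 0) (body (x 0)))" for i
  proof (rule grassmann_eqI)
    fix B :: "nat set" assume "finite B"
    then show "coeff (multi_deriv 1 i ?f (\<lambda>k. body (x k))) B
        = coeff (of_real (D (i 0) (body (x 0)))) B"
      using iterated_partial_deriv[OF D, of "\<lambda>k. body (x k)" "i 0" "coeff 1 B"] b
      by (simp add: multi_deriv.rep_eq coeff_of_real)
  qed
  have summand: "coeff (taylor_term 1 ?f x i) A = ?a (i 0)" for i
    unfolding taylor_term_def md by (simp add: of_real_def scaleR_grassmann.rep_eq)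
  \<comment> \<open>For \<open>m = 1\<close> an order of differentiation is a sequence supported at \<open>0\<close>, that is, a number.\<close>
  have bij: "bij_betw (\<lambda>n k. if k = 0 then n else 0) UNIV ?I"
    by (rule bij_betw_byWitness[where f' = "\<lambda>i. i 0"]) (auto simp: fun_eq_iff)
  have "coeff (grassmann_ext 1 ?f x) A = (\<Sum>\<^sub>\<infinity>i\<in>?I. ?a (i 0))"
    unfolding coeff_grassmann_ext summand ..
  also have "\<dots> = (\<Sum>\<^sub>\<infinity>n\<in>UNIV. ?a n)"
    using infsum_reindex_bij_betw[OF bij, of "\<lambda>i. ?a (i 0)"] by simp
  also have "\<dots> = (\<Sum>\<^sub>\<infinity>n\<in>{..N}. ?a n)"
    by (rule infsum_cong_neutral)
      (use A in \<open>auto simp: scaleR_grassmann.rep_eq coeff_soul_power_eq_0\<close>)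
  finally show ?thesis by (simp add: coeff_sum)
qed

definition superline :: "grassmann \<Rightarrow> superpoint"
  where "superline t = ((\<lambda>k. if k = 0 then t else 0), \<lambda>_. 0)"

lemma superspace_1_0: "superspace 1 0 = superline ` grassmann_even"
proof
  show "superspace 1 0 \<subseteq> superline ` grassmann_even"
  proof
    fix p assume "p \<in> superspace 1 0"
    then have "p = superline (fst p 0)" "fst p 0 \<in> grassmann_even"
      by (auto simp: superspace_def superline_def fun_eq_iff)
    then show "p \<in> superline ` grassmann_even" by blast
  qed
qed (auto simp: superspace_def superline_def)

lemma fst_superline [simp]: "fst (superline t) 0 = t"
  by (simp add: superline_def)

lemma dewitt_open_superline:
  assumes "open W"
  shows "dewitt_open 1 0 (superline ` {t \<in> grassmann_even. body t \<in> W})"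
  unfolding dewitt_open_def
proof (intro exI conjI)
  let ?V = "{p \<in> topspace (Euclidean_space 1). p 0 \<in> W}"
  have "continuous_map (Euclidean_space 1) euclideanreal (\<lambda>p. p 0)"
    by (auto simp: Euclidean_space_def
        intro!: continuous_map_from_subtopology continuous_map_product_projection)
  then show "openin (Euclidean_space 1) ?V"
    by (rule openin_continuous_map_preimage) (use assms in simp)
  have "body_map (superline t) \<in> ?V \<longleftrightarrow> body t \<in> W" for t
    by (simp add: body_map_def superline_def topspace_Euclidean_space)
  then show "superline ` {t \<in> grassmann_even. body t \<in> W} = {p \<in> superspace 1 0. body_map p \<in> ?V}"
    unfolding superspace_1_0 by blast
qed

lemma G_infinity_one_variable:
  assumes D: "derivative_sequence W D"
    and U: "\<And>x \<xi>. (x, \<xi>) \<in> U \<Longrightarrow> body (x 0) \<in> W"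
    and h: "\<And>x \<xi>. (x, \<xi>) \<in> U \<Longrightarrow> h (x, \<xi>) = grassmann_ext 1 (\<lambda>p. of_real (D 0 (p 0))) x"
  shows "G_infinity 1 0 U h"
  unfolding G_infinity_def
proof (intro exI conjI)
  let ?f = "\<lambda>(_ :: nat set) (p :: nat \<Rightarrow> real). of_real (D 0 (p 0)) :: grassmann"
  have "smooth_on 1 (body_map ` U) (\<lambda>p. of_real (D 0 (p 0)))"
    by (rule smooth_on_one_variable[OF D]) (use U in \<open>auto simp: body_map_def\<close>)
  then show "\<forall>M\<in>Pow {..<0}. smooth_on 1 (body_map ` U) (?f M)" by simp
  show "\<forall>(x, \<xi>)\<in>U. h (x, \<xi>) =
      (\<Sum>M\<in>Pow {..<0}. grassmann_ext 1 (?f M) x * prod_list (map \<xi> (sorted_list_of_set M)))"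
    using h by auto
qed

lemma G_infinity_map_superline:
  assumes "\<And>p. p \<in> U \<Longrightarrow> F p = superline (h p) \<and> h p \<in> grassmann_even"
    and "G_infinity 1 0 U h"
  shows "G_infinity_map 1 0 1 0 U F"
proof -
  have "G_infinity 1 0 U (\<lambda>p. fst (F p) 0)"
    using assms(2) unfolding G_infinity_def by (simp add: assms(1) split_def cong: ball_cong)
  moreover have "F ` U \<subseteq> superspace 1 0"
    unfolding superspace_1_0 using assms(1) by auto
  ultimately show ?thesis by (simp add: G_infinity_map_def)
qed

lemma G_infinity_coordinate: "G_infinity 1 0 U (\<lambda>p. fst p 0)"
proof (rule G_infinity_one_variable[where W = UNIV])
  let ?D = "\<lambda>(n::nat) t::real. if n = 0 then t else if n = 1 then 1 else 0"
  show D: "derivative_sequence UNIV ?D" by (auto simp: derivative_sequence_def)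
  fix x :: "nat \<Rightarrow> grassmann" and \<xi> :: "nat \<Rightarrow> grassmann"
  show "fst (x, \<xi>) 0 = grassmann_ext 1 (\<lambda>p. of_real (?D 0 (p 0))) x"
  proof (rule grassmann_eqI)
    fix A :: "nat set" assume A: "finite A"
    \<comment> \<open>The bound \<open>card A\<close> would cut off the linear term when \<open>A\<close> is empty.\<close>
    have "(\<Sum>n\<le>Suc (card A). (?D n (body (x 0)) / fact n) *\<^sub>R soul (x 0) ^ n)
        = (\<Sum>n\<in>{0, 1}. (?D n (body (x 0)) / fact n) *\<^sub>R soul (x 0) ^ n)"
      by (rule sum.mono_neutral_right) auto
    also have "\<dots> = x 0" using body_plus_soul[of "x 0"] by (simp add: of_real_def)
    finally show "coeff (fst (x, \<xi>) 0) A
        = coeff (grassmann_ext 1 (\<lambda>p. of_real (?D 0 (p 0))) x) A"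
      using coeff_ext_one_variable[OF D, where x = x and A = A and N = "Suc (card A)"] A
      by simp
  qed
qed auto

section \<open>Inversion\<close>

definition inverse_deriv :: "nat \<Rightarrow> real \<Rightarrow> real"
  where "inverse_deriv n t = (- 1) ^ n * fact n * inverse t ^ Suc n"

lemma derivative_sequence_inverse: "derivative_sequence (- {0}) inverse_deriv"
  unfolding derivative_sequence_def
proof (intro conjI allI ballI)
  fix n and t :: real assume t: "t \<in> - {0}"
  show "(inverse_deriv n has_real_derivative inverse_deriv (Suc n) t) (at t)"
    unfolding inverse_deriv_def
    by (rule derivative_eq_intros refl | use t in \<open>simp add: field_simps power2_eq_square\<close>)+
qed auto

text \<open>Defining the inverse as a Grassmann extension makes it \<open>G\<^sup>\<infinity>\<close> by construction; that it is the inverse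
  in the algebra is a theorem.\<close>

definition super_inverse :: "grassmann \<Rightarrow> grassmann"
  where "super_inverse x = grassmann_ext 1 (\<lambda>p. of_real (inverse_deriv 0 (p 0))) (\<lambda>_. x)"

lemma coeff_super_inverse:
  assumes "body x \<noteq> 0" "finite A" "card A \<le> N"
  shows "coeff (super_inverse x) A
    = coeff (\<Sum>n\<le>N. ((- 1) ^ n * inverse (body x) ^ Suc n) *\<^sub>R soul x ^ n) A"
proof -
  from coeff_ext_one_variable[OF derivative_sequence_inverse, where x = "\<lambda>_. x"] assms
  show ?thesis by (simp add: super_inverse_def inverse_deriv_def)
qed

lemma super_inverse_even [simp, intro]:
  assumes "x \<in> grassmann_even" "body x \<noteq> 0"
  shows "super_inverse x \<in> grassmann_even"
  unfolding grassmann_even_def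
proof (intro CollectI allI impI)
  fix A :: "nat set" assume A: "odd (card A)"
  then have "finite A" using card.infinite by fastforce
  moreover have "coeff (soul x ^ n) A = 0" for n
    using even_power[OF even_soul[OF assms(1)]] A by (auto simp: grassmann_even_def)
  ultimately show "coeff (super_inverse x) A = 0"
    using coeff_super_inverse[OF assms(2) _ order_refl]
    by (simp add: coeff_sum scaleR_grassmann.rep_eq)
qed

text \<open>With \<open>b\<close> the body of \<open>x\<close>, the partial sum of order \<open>N\<close> multiplied by \<open>x = b + soul x\<close> telescopes to
  \<open>1 - (- soul x / b)\<^bsup>N + 1\<^esup>\<close>, and the last power vanishes at multi indices of length \<open>N\<close>.\<close>

lemma super_inverse_right [simp]:
  assumes "body x \<noteq> 0"
  shows "x * super_inverse x = 1"
proof (rule grassmann_eqI)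
  fix A :: "nat set" assume A: "finite A"
  define N where "N = card A"
  define b where "b = body x"
  define g where "g n = ((- 1) ^ n * inverse b ^ Suc n) *\<^sub>R soul x ^ n" for n
  define h where "h n = ((- inverse b) ^ n) *\<^sub>R soul x ^ n" for n
  have "x * g n = h n - h (Suc n)" for n
  proof -
    have "x * g n = b *\<^sub>R g n + soul x * g n"
      by (subst body_plus_soul[of x, symmetric]) (simp add: b_def of_real_def distrib_right)
    moreover have "b *\<^sub>R g n = h n"
      using assms by (simp add: g_def h_def b_def power_minus[of "inverse (body x)"])
    moreover have "soul x * g n = - h (Suc n)"
      by (simp add: g_def h_def power_minus[of "inverse b"])
    ultimately show ?thesis by simp
  qed
  then have "x * (\<Sum>n\<le>N. g n) = h 0 - h (Suc N)"
    by (simp add: sum_distrib_left sum_telescope)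
  moreover have "coeff (x * super_inverse x) A = coeff (x * (\<Sum>n\<le>N. g n)) A"
  proof (rule coeff_times_cong)
    fix B assume "B \<subseteq> A"
    with A show "coeff (super_inverse x) B = coeff (\<Sum>n\<le>N. g n) B"
      unfolding g_def b_def N_def
      by (intro coeff_super_inverse assms) (auto intro: finite_subset card_mono)
  qed simp
  moreover have "coeff (h (Suc N)) A = 0"
    unfolding h_def scaleR_grassmann.rep_eq using coeff_soul_power_eq_0[OF A, of "Suc N" x] N_def
    by simp
  ultimately have "coeff (x * super_inverse x) A = coeff (h 0) A"
    by (simp only: minus_grassmann.rep_eq diff_zero)
  then show "coeff (x * super_inverse x) A = coeff 1 A" by (simp add: h_def)
qed

lemma super_inverse_unique:
  assumes "y * x = 1" "body x \<noteq> 0"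
  shows "super_inverse x = y"
  using assms by (metis mult.assoc mult.left_neutral mult.right_neutral super_inverse_right)

lemma super_inverse_left [simp]:
  assumes "x \<in> grassmann_even" "body x \<noteq> 0"
  shows "super_inverse x * x = 1"
  using even_central[OF assms(1)] assms(2) by (metis super_inverse_right)

lemma body_super_inverse [simp]:
  assumes "body x \<noteq> 0"
  shows "body (super_inverse x) = inverse (body x)"
proof -
  have "body (x * super_inverse x) = 1" using assms by simp
  then show ?thesis using assms unfolding body_simps(8) by (simp add: field_simps)
qed

lemma G_infinity_super_inverse:
  assumes "\<And>x \<xi>. (x, \<xi>) \<in> U \<Longrightarrow> body (x 0) \<noteq> 0"
  shows "G_infinity 1 0 U (\<lambda>p. super_inverse (fst p 0))"
proof (rule G_infinity_one_variable[OF derivative_sequence_inverse])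
  show "super_inverse (fst (x, \<xi>) 0) = grassmann_ext 1 (\<lambda>p. of_real (inverse_deriv 0 (p 0))) x"
    if "(x, \<xi>) \<in> U" for x \<xi>
  proof (rule grassmann_eqI)
    fix A :: "nat set" assume A: "finite A"
    from coeff_ext_one_variable[OF derivative_sequence_inverse, where A = A and N = "card A"]
    show "coeff (super_inverse (fst (x, \<xi>) 0)) A
      = coeff (grassmann_ext 1 (\<lambda>p. of_real (inverse_deriv 0 (p 0))) x) A"
      using A assms[OF that] unfolding super_inverse_def by simp
  qed
qed (use assms in auto)

section \<open>Stereographic projection\<close>

text \<open>The parameter \<open>s = \<plusminus>1\<close>, always given by \<open>s * s = 1\<close>, names the pole \<open>(0, s)\<close> of
  projection.  All points whose body is the pole have to be left out, not only the pole: \<open>1 - s y\<close> is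
  invertible only if its body is not zero.\<close>

definition circle_part :: "real \<Rightarrow> superpoint set"
  where "circle_part s = {p \<in> supercircle. body (fst p 1) \<noteq> s}"

definition stereographic :: "real \<Rightarrow> superpoint \<Rightarrow> grassmann"
  where "stereographic s p = fst p 0 * super_inverse (1 - s *\<^sub>R fst p 1)"

definition circle_param :: "real \<Rightarrow> grassmann \<Rightarrow> superpoint"
  where "circle_param s t = ((\<lambda>k.
    if k = 0 then 2 *\<^sub>R (t * super_inverse (1 + t\<^sup>2))
    else if k = 1 then s *\<^sub>R ((t\<^sup>2 - 1) * super_inverse (1 + t\<^sup>2)) else 0), \<lambda>_. 0)"

lemma circle_param_simps [simp]:
  "fst (circle_param s t) 0 = 2 *\<^sub>R (t * super_inverse (1 + t\<^sup>2))"
  "fst (circle_param s t) 1 = s *\<^sub>R ((t\<^sup>2 - 1) * super_inverse (1 + t\<^sup>2))"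
  by (simp_all add: circle_param_def)

lemma one_plus_square_neq_0 [simp]: "1 + (b::real)\<^sup>2 \<noteq> 0"
  using zero_le_power2[of b] by linarith

lemma square_mult:
  fixes a b :: "'a :: monoid_mult"
  assumes "a * b = b * a"
  shows "(a * b)\<^sup>2 = a\<^sup>2 * b\<^sup>2"
  by (metis assms mult.assoc power2_eq_square)

text \<open>The circle equation is the identity \<open>4 q + (q - 1)\<^sup>2 = (1 + q)\<^sup>2\<close> for \<open>q = t\<^sup>2\<close>.  The pole is avoided
  because \<open>(b\<^sup>2 - 1) / (1 + b\<^sup>2)\<close> is never \<open>1\<close> for real \<open>b\<close>.\<close>

lemma circle_param_in_part:
  assumes t: "t \<in> grassmann_even" and s: "s * s = 1"
  shows "circle_param s t \<in> circle_part s"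
proof -
  define q where "q = t\<^sup>2"
  define u where "u = super_inverse (1 + q)"
  have q: "q \<in> grassmann_even" and b: "body (1 + q) \<noteq> 0" using t by (simp_all add: q_def)
  then have u: "u \<in> grassmann_even" and inv: "(1 + q) * u = 1" by (simp_all add: u_def)
  have "4 *\<^sub>R q = q + q + (q + q)" by (simp flip: scaleR_2)
  then have poly: "4 *\<^sub>R q + (q - 1)\<^sup>2 = (1 + q)\<^sup>2"
    by (simp add: power2_eq_square algebra_simps)
  have "(2 *\<^sub>R (t * u))\<^sup>2 + (s *\<^sub>R ((q - 1) * u))\<^sup>2 = 4 *\<^sub>R (t * u)\<^sup>2 + ((q - 1) * u)\<^sup>2"
    using s by (simp add: power2_eq_square)
  also have "\<dots> = (4 *\<^sub>R q + (q - 1)\<^sup>2) * u\<^sup>2"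
    using square_mult[of t u] square_mult[of "q - 1" u] even_central[OF u]
    by (simp add: q_def distrib_right)
  also have "\<dots> = ((1 + q) * u)\<^sup>2"
    unfolding poly by (rule square_mult[symmetric]) (rule even_central[OF u, symmetric])
  finally have circle: "(2 *\<^sub>R (t * u))\<^sup>2 + (s *\<^sub>R ((q - 1) * u))\<^sup>2 = 1" by (simp add: inv)
  have "circle_param s t \<in> superspace 2 0"
    using t q u by (auto simp: circle_param_def superspace_def q_def u_def)
  moreover have "body (s *\<^sub>R ((q - 1) * u)) \<noteq> s"
  proof -
    have "((body t)\<^sup>2 - 1) * inverse (1 + (body t)\<^sup>2) \<noteq> 1"
      by (simp add: divide_eq_1_iff flip: divide_inverse)
    moreover have "s \<noteq> 0" using s by auto
    ultimately show ?thesis by (simp add: u_def q_def)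
  qed
  ultimately show ?thesis
    using circle by (simp add: circle_part_def supercircle_def q_def u_def del: One_nat_def)
qed

lemma circle_partD:
  assumes "p \<in> circle_part s" "s * s = 1"
  shows "fst p 0 \<in> grassmann_even" "fst p 1 \<in> grassmann_even"
    "(fst p 0)\<^sup>2 + (fst p 1)\<^sup>2 = 1" "body (1 - s *\<^sub>R fst p 1) \<noteq> 0"
proof -
  show "fst p 0 \<in> grassmann_even" "fst p 1 \<in> grassmann_even" "(fst p 0)\<^sup>2 + (fst p 1)\<^sup>2 = 1"
    using assms(1) by (auto simp: circle_part_def supercircle_def superspace_def)
  have "s * (1 - s * body (fst p 1)) \<noteq> 0"
    using assms by (simp add: circle_part_def right_diff_distrib flip: mult.assoc)
  then show "body (1 - s *\<^sub>R fst p 1) \<noteq> 0" by simp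
qed

lemma stereographic_even:
  assumes "p \<in> circle_part s" "s * s = 1"
  shows "stereographic s p \<in> grassmann_even"
  using circle_partD[OF assms] by (auto simp: stereographic_def intro!: even_mult super_inverse_even)

text \<open>The point with parameter \<open>t\<close> has \<open>1 - s y = 2 u\<close>, where \<open>u\<close> is the inverse of \<open>1 + t\<^sup>2\<close>.  Hence
  \<open>x / (1 - s y) = 2 t u / (2 u) = t\<close>.\<close>

lemma stereographic_circle_param:
  assumes t: "t \<in> grassmann_even" and s: "s * s = 1"
  shows "stereographic s (circle_param s t) = t"
proof -
  define q where "q = t\<^sup>2"
  define u where "u = super_inverse (1 + q)"
  have q: "1 + q \<in> grassmann_even" and b: "body (1 + q) \<noteq> 0" using t by (simp_all add: q_def)
  then have inv: "(1 + q) * u = 1" "u * (1 + q) = 1" and bu: "body u \<noteq> 0"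
    by (simp_all add: u_def)
  have "1 - (q - 1) * u = (1 + q) * u - (q - 1) * u" by (simp add: inv)
  also have "\<dots> = 2 *\<^sub>R u" by (simp add: scaleR_2 algebra_simps)
  finally have w: "1 - s *\<^sub>R (s *\<^sub>R ((q - 1) * u)) = 2 *\<^sub>R u" using s by simp
  have "super_inverse (2 *\<^sub>R u) = (1 / 2) *\<^sub>R (1 + q)"
    by (rule super_inverse_unique) (use inv bu in simp_all)
  then have "stereographic s (circle_param s t) = 2 *\<^sub>R (t * u) * ((1 / 2) *\<^sub>R (1 + q))"
    unfolding stereographic_def circle_param_simps using w by (simp add: q_def u_def)
  also have "\<dots> = t * (u * (1 + q))" by (simp add: mult.assoc)
  finally show ?thesis by (simp add: inv)
qed

text \<open>Put \<open>w = 1 - s y\<close> and \<open>t = x / w\<close>.  On the circle \<open>x\<^sup>2 = (1 + s y) w\<close>, which gives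
  \<open>1 + t\<^sup>2 = 2 / w\<close>; so \<open>u = w / 2\<close>, and the coordinates can be read off.\<close>

lemma circle_param_stereographic:
  assumes p: "p \<in> circle_part s" and s: "s * s = 1"
  shows "circle_param s (stereographic s p) = p"
proof -
  define x where "x = fst p 0"
  define y where "y = fst p 1"
  define w where "w = 1 - s *\<^sub>R y"
  define v where "v = super_inverse w"
  define t where "t = x * v"
  note D = circle_partD[OF p s, folded x_def y_def, folded w_def]
  have w: "w \<in> grassmann_even" using D by (simp add: w_def)
  have v: "v \<in> grassmann_even" and bv: "body v \<noteq> 0" and inv: "w * v = 1" "v * w = 1"
    using w D(4) by (simp_all add: v_def)
  have t: "stereographic s p = t" by (simp add: stereographic_def t_def v_def w_def x_def y_def)
  have "x\<^sup>2 = 1 - y\<^sup>2" using D(3) by (simp add: algebra_simps)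
  also have "\<dots> = (1 + s *\<^sub>R y) * w"
    using s by (simp add: w_def power2_eq_square algebra_simps)
  finally have x2: "x\<^sup>2 = (1 + s *\<^sub>R y) * w" .
  have "t\<^sup>2 = (1 + s *\<^sub>R y) * w * v\<^sup>2"
    unfolding t_def x2[symmetric] by (rule square_mult) (rule even_central[OF D(1)])
  also have "\<dots> = (1 + s *\<^sub>R y) * (w * v) * v" by (simp add: power2_eq_square mult.assoc)
  finally have "1 + t\<^sup>2 = w * v + (1 + s *\<^sub>R y) * v" using inv by simp
  also have "\<dots> = 2 *\<^sub>R v" by (simp add: w_def scaleR_2 algebra_simps)
  finally have t2: "1 + t\<^sup>2 = 2 *\<^sub>R v" .
  have u: "super_inverse (1 + t\<^sup>2) = (1 / 2) *\<^sub>R w"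
    unfolding t2 by (rule super_inverse_unique) (use inv bv in simp_all)
  have X: "fst (circle_param s t) 0 = x"
    unfolding circle_param_simps u by (simp add: t_def mult.assoc inv)
  have "t\<^sup>2 - 1 = (1 + t\<^sup>2) - 2 *\<^sub>R 1" by (simp add: scaleR_2)
  then have "t\<^sup>2 - 1 = 2 *\<^sub>R v - 2 *\<^sub>R 1" unfolding t2 .
  then have "(t\<^sup>2 - 1) * ((1 / 2) *\<^sub>R w) = v * w - w" by (simp only: left_diff_distrib) simp
  then have "(t\<^sup>2 - 1) * ((1 / 2) *\<^sub>R w) = s *\<^sub>R y" unfolding inv by (simp add: w_def)
  then have Y: "fst (circle_param s t) 1 = y"
    unfolding circle_param_simps u using s by simp
  have "p \<in> superspace 2 0" using p by (simp add: circle_part_def supercircle_def)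
  then have z: "k \<noteq> 0 \<Longrightarrow> k \<noteq> 1 \<Longrightarrow> fst p k = 0" and odd: "snd p = (\<lambda>_. 0)" for k
    by (auto simp: superspace_def)
  have "fst (circle_param s t) k = fst p k" for k
    using X Y z[of k] by (cases "k = 0 \<or> k = 1") (auto simp: x_def y_def circle_param_def)
  then show ?thesis unfolding t using odd by (auto simp: prod_eq_iff circle_param_def)
qed

text \<open>Here the denominator is \<open>1 + s y = 2 t\<^sup>2 u\<close>, so the projection from the other pole is
  \<open>2 t u / (2 t\<^sup>2 u) = 1 / t\<close>.\<close>

lemma stereographic_opposite:
  assumes t: "t \<in> grassmann_even" and s: "s * s = 1" and bt: "body t \<noteq> 0"
  shows "stereographic (- s) (circle_param s t) = super_inverse t"
proof -
  define q where "q = t\<^sup>2"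
  define u where "u = super_inverse (1 + q)"
  define i where "i = super_inverse t"
  have q: "1 + q \<in> grassmann_even" and b: "body (1 + q) \<noteq> 0" using t by (simp_all add: q_def)
  then have inv: "(1 + q) * u = 1" "u * (1 + q) = 1" and bu: "body u \<noteq> 0"
    by (simp_all add: u_def)
  have i: "t * i = 1" "i * t = 1" using t bt by (simp_all add: i_def)
  have iq: "i * i * q = 1"
    by (metis i(2) mult.assoc mult.left_neutral power2_eq_square q_def)
  have "1 + (q - 1) * u = (1 + q) * u + (q - 1) * u" by (simp add: inv)
  also have "\<dots> = 2 *\<^sub>R (q * u)" by (simp add: scaleR_2 algebra_simps)
  finally have w: "1 + s *\<^sub>R (s *\<^sub>R ((q - 1) * u)) = 2 *\<^sub>R (q * u)" using s by simp
  have "super_inverse (2 *\<^sub>R (q * u)) = (1 / 2) *\<^sub>R ((1 + q) * (i * i))"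
  proof (rule super_inverse_unique)
    have "(1 + q) * (i * i) * (q * u) = (1 + q) * (i * i * q) * u" by (simp only: mult.assoc)
    then show "(1 / 2) *\<^sub>R ((1 + q) * (i * i)) * 2 *\<^sub>R (q * u) = 1" by (simp add: iq inv)
    show "body (2 *\<^sub>R (q * u)) \<noteq> 0" using bt bu by (simp add: q_def)
  qed
  then have "stereographic (- s) (circle_param s t)
      = 2 *\<^sub>R (t * u) * ((1 / 2) *\<^sub>R ((1 + q) * (i * i)))"
    unfolding stereographic_def circle_param_simps using w by (simp add: q_def u_def)
  also have "\<dots> = t * (u * (1 + q)) * i * i" by (simp add: mult.assoc)
  also have "\<dots> = i" by (simp add: inv i)
  finally show ?thesis unfolding i_def .
qed

lemma circle_param_in_opposite_part:
  assumes t: "t \<in> grassmann_even" and s: "s * s = 1"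
  shows "circle_param s t \<in> circle_part (- s) \<longleftrightarrow> body t \<noteq> 0"
proof -
  have "circle_param s t \<in> supercircle"
    using circle_param_in_part[OF assms] by (simp add: circle_part_def)
  moreover have "s \<noteq> 0" using s by auto
  moreover have "s * r = - s \<longleftrightarrow> r = - 1" if "s \<noteq> 0" for r :: real
    using that by (metis mult_cancel_left mult_minus1_right)
  moreover have "((body t)\<^sup>2 - 1) / (1 + (body t)\<^sup>2) = - 1 \<longleftrightarrow> body t = 0"
    by (simp add: divide_eq_eq)
  ultimately show ?thesis
    by (simp add: circle_part_def divide_inverse del: One_nat_def)
qed

definition stereographic_chart :: "real \<Rightarrow> superpoint \<Rightarrow> superpoint"
  where "stereographic_chart s p = superline (stereographic s p)"

lemma inj_on_stereographic_chart:
  assumes "s * s = 1"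
  shows "inj_on (stereographic_chart s) (circle_part s)"
  by (rule inj_on_inverseI[where g = "\<lambda>p. circle_param s (fst p 0)"])
    (simp add: stereographic_chart_def circle_param_stereographic assms)

lemma inv_stereographic_chart:
  assumes "s * s = 1" "t \<in> grassmann_even"
  shows "inv_into (circle_part s) (stereographic_chart s) (superline t) = circle_param s t"
  by (rule inv_into_f_eq[OF inj_on_stereographic_chart])
    (use assms in \<open>auto simp: circle_param_in_part stereographic_chart_def stereographic_circle_param\<close>)

lemma stereographic_chart_image:
  assumes "s * s = 1"
  shows "stereographic_chart s ` (circle_part s \<inter> D)
    = superline ` {t \<in> grassmann_even. circle_param s t \<in> D}"
proof (intro equalityI subsetI)
  fix z assume "z \<in> superline ` {t \<in> grassmann_even. circle_param s t \<in> D}"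
  then obtain t where "t \<in> grassmann_even" "circle_param s t \<in> D" "z = superline t" by auto
  then show "z \<in> stereographic_chart s ` (circle_part s \<inter> D)"
    using assms circle_param_in_part stereographic_circle_param
    by (intro image_eqI[of _ _ "circle_param s t"]) (auto simp: stereographic_chart_def)
qed (auto simp: stereographic_chart_def stereographic_even circle_param_stereographic assms)

lemma stereographic_transition:
  assumes s: "s * s = 1" and r: "r = s \<or> r = - s"
  defines "Z \<equiv> stereographic_chart s ` (circle_part r \<inter> circle_part s)"
  shows "dewitt_open 1 0 Z"
    and "G_infinity_map 1 0 1 0 Z
      (stereographic_chart r \<circ> inv_into (circle_part s) (stereographic_chart s))"
proof -
  let ?F = "stereographic_chart r \<circ> inv_into (circle_part s) (stereographic_chart s)"
  have Z: "Z = superline ` {t \<in> grassmann_even. circle_param s t \<in> circle_part r}"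
    unfolding Z_def Int_commute[of "circle_part r"] by (rule stereographic_chart_image[OF s])
  have F: "?F (superline t) = superline (stereographic r (circle_param s t))"
    if "t \<in> grassmann_even" for t
    using inv_stereographic_chart[OF s that] by (simp add: stereographic_chart_def)
  have "dewitt_open 1 0 Z \<and> G_infinity_map 1 0 1 0 Z ?F"
  proof (cases "r = s")
    case True
    then have Z: "Z = superline ` {t \<in> grassmann_even. body t \<in> UNIV}"
      using Z circle_param_in_part[OF _ s] by auto
    have "G_infinity_map 1 0 1 0 Z ?F"
      by (rule G_infinity_map_superline[OF _ G_infinity_coordinate])
        (use True s F in \<open>auto simp: Z stereographic_circle_param\<close>)
    then show ?thesis using Z dewitt_open_superline[of UNIV] by simp
  next
    case False
    then have r: "r = - s" using r by simp
    then have Z: "Z = superline ` {t \<in> grassmann_even. body t \<in> - {0}}"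
      using Z circle_param_in_opposite_part[OF _ s] by auto
    have "G_infinity 1 0 Z (\<lambda>p. super_inverse (fst p 0))"
      by (rule G_infinity_super_inverse) (auto simp: Z superline_def)
    then have "G_infinity_map 1 0 1 0 Z ?F"
      by (rule G_infinity_map_superline[rotated])
        (use r s F in \<open>auto simp: Z stereographic_opposite\<close>)
    moreover have "dewitt_open 1 0 Z"
      unfolding Z by (rule dewitt_open_superline) auto
    ultimately show ?thesis by simp
  qed
  then show "dewitt_open 1 0 Z" "G_infinity_map 1 0 1 0 Z ?F" by auto
qed

theorem proposition4p2:
  shows "supermanifold 1 0 supercircle"
proof -
  define S :: "real set" where "S = {1, - 1}"
  have "circle_part s \<subseteq> supercircle \<and>
      (\<exists>W. dewitt_open 1 0 W \<and> bij_betw (stereographic_chart s) (circle_part s) W)"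
    if "s \<in> S" for s
  proof -
    have s: "s * s = 1" using that by (auto simp: S_def)
    then have "dewitt_open 1 0 (stereographic_chart s ` circle_part s)"
      using stereographic_transition(1)[of s s] by simp
    then show ?thesis
      using inj_on_stereographic_chart[OF s] by (auto simp: bij_betw_def circle_part_def)
  qed
  moreover have "(\<Union>s\<in>S. circle_part s) = supercircle"
    by (auto simp: circle_part_def S_def)
  moreover have "dewitt_open 1 0 (stereographic_chart s ` (circle_part r \<inter> circle_part s)) \<and>
      G_infinity_map 1 0 1 0 (stereographic_chart s ` (circle_part r \<inter> circle_part s))
        (stereographic_chart r \<circ> inv_into (circle_part s) (stereographic_chart s))"
    if "s \<in> S" "r \<in> S" for r s
    using that stereographic_transition[of s r] by (auto simp: S_def)
  ultimately show ?thesis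
    unfolding supermanifold_def super_atlas_def
    by (intro exI[of _ "(\<lambda>s. (circle_part s, stereographic_chart s)) ` S"]) simp
qed

end
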